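(* Let $\alpha>0$ be a fixed real number. Let $k=k(n)$ and $m=m(n)$ be functions of $n$ such that $k\geq 2$ and $m=\lfloor n^\alpha\rfloor$. (i) If $\liminf_{n\rightarrow\infty} \frac{k^2n}{m\log n}>1$, then asymptotically almost surely $G(n,m,k)$ is connected. (ii) If $\limsup_{n\rightarrow\infty} \frac{k^2n}{m\log n}<1$, then asymptotically almost surely $G(n,m,k)$ is not connected.
   Context: The uniform random intersection graph $G(n,m,k)$ (for positive integers $k\le m$) is the random graph on a set $V$ of $n$ nodes defined as follows: fix a set $M$ of $m$ colours; to each node $v\in V$ assign a subset $F_v\subseteq M$ of exactly $k$ distinct colours, chosen uniformly at random among all $k$-subsets of $M$, independently for different nodes; distinct nodes $u,v$ are joined by an edge if and only if $F_u\cap F_v\neq\emptyset$. An event holds asymptotically almost surely if its probability tends to $1$ as $n\rightarrow\infty$. Here $\log$ denotes the natural logarithm. *)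

theory Defs
  imports "HOL-Analysis.Analysis" "HOL-Library.Liminf_Limsup"
begin

text \<open>Nodes are {..<n}, colours are {..<m}.  A colour assignment gives each node a
  k-subset of the colours; the uniform random intersection graph G(n,m,k) is the uniform
  distribution on the (finite) set of all such assignments.\<close>

definition ksubsets :: "nat \<Rightarrow> nat \<Rightarrow> nat set set" where
  "ksubsets m k = {S. S \<subseteq> {..<m} \<and> card S = k}"

definition assignments :: "nat \<Rightarrow> nat \<Rightarrow> nat \<Rightarrow> (nat \<Rightarrow> nat set) set" where
  "assignments n m k = PiE {..<n} (\<lambda>_. ksubsets m k)"

text \<open>Edge relation of the intersection graph determined by an assignment F.\<close>
definition ig_edges :: "nat \<Rightarrow> (nat \<Rightarrow> nat set) \<Rightarrow> (nat \<times> nat) set" where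
  "ig_edges n F = {(u, v). u < n \<and> v < n \<and> u \<noteq> v \<and> F u \<inter> F v \<noteq> {}}"

definition ig_connected :: "nat \<Rightarrow> (nat \<Rightarrow> nat set) \<Rightarrow> bool" where
  "ig_connected n F \<longleftrightarrow> (\<forall>u<n. \<forall>v<n. (u, v) \<in> (ig_edges n F)\<^sup>*)"

text \<open>Probability that G(n,m,k) is connected.\<close>
definition prob_connected :: "nat \<Rightarrow> nat \<Rightarrow> nat \<Rightarrow> real" where
  "prob_connected n m k =
     real (card {F \<in> assignments n m k. ig_connected n F}) / real (card (assignments n m k))"

end

theory Submission
  imports Defs "HOL-Real_Asymp.Real_Asymp"
begin

text \<open>
  Write \<open>F\<^sub>S\<close> for the set of colours used by a set \<open>S\<close> of \<open>s\<close> nodes.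

  Above the threshold with \<open>\<alpha> \<ge> 1\<close> we have \<open>n \<le> m\<close> and \<open>k \<rightarrow> \<infinity>\<close>. A disconnected graph has a set \<open>S\<close>
  of at most \<open>n/2\<close> nodes with no edge to its complement. Either \<open>F\<^sub>S\<close> has at most
  \<open>x = min ((1 - \<delta>) k s) (c m)\<close> colours, with probability at most \<open>(m choose x) (x/m)^(ks)\<close>,
  or the other \<open>n - s\<close> nodes all avoid more than \<open>x\<close> colours, with probability at most
  \<open>exp (- k x (n - s) / m)\<close>. For suitable constants \<open>\<delta>\<close> and \<open>c\<close> both bounds beat the number
  \<open>n choose s\<close> of choices of \<open>S\<close>, uniformly in \<open>s\<close>, and the union bound is dominated by
  geometric series.

  For \<open>\<alpha> < 1\<close> one takes the union bound over colour sets instead: if the graph is disconnected then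
  there is a nonempty set \<open>A\<close> of \<open>a \<le> m/2\<close> colours such that each node has its colours inside
  \<open>A\<close> or inside its complement. Since \<open>k \<ge> 2\<close>, this has probability at most \<open>exp (- n a / m)\<close>.

  Below the threshold, the second moment of the number of isolated nodes shows that one exists.
  With \<open>q\<close> the probability that two random colour sets are disjoint, the probability that a third
  set avoids two disjoint ones is at most \<open>q\<^sup>2\<close>, by log-concavity of \<open>a \<mapsto> (a choose k)\<close>.
\<close>

subsection \<open>Counting colour assignments\<close>

lemma finite_ksubsets [simp]: "finite (ksubsets m k)"
  unfolding ksubsets_def by (rule finite_subset[of _ "Pow {..<m}"]) auto

lemma card_ksubsets: "card (ksubsets m k) = m choose k"
  unfolding ksubsets_def using n_subsets[of "{..<m}" k] by simp

lemma finite_assignments [simp]: "finite (assignments n m k)"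
  unfolding assignments_def by (intro finite_PiE) auto

lemma card_assignments: "card (assignments n m k) = (m choose k) ^ n"
  unfolding assignments_def by (simp add: card_PiE card_ksubsets)

lemma prob_disconnected_eq:
  assumes "k \<le> m"
  shows "1 - prob_connected n m k =
    real (card {F \<in> assignments n m k. \<not> ig_connected n F}) / real (m choose k) ^ n"
proof -
  have "card (assignments n m k) =
      card {F \<in> assignments n m k. ig_connected n F} + card {F \<in> assignments n m k. \<not> ig_connected n F}"
    by (subst card_Un_disjoint[symmetric]) (auto intro: arg_cong[where f = card])
  moreover have "real (m choose k) ^ n > 0" using assms by simp
  ultimately show ?thesis
    unfolding prob_connected_def
    by (simp add: field_simps card_assignments flip: of_nat_power)
qed

lemma card_PiE_two_blocks:
  fixes n :: nat
  assumes "S \<subseteq> {..<n}"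
  shows "card (PiE {..<n} (\<lambda>v. if v \<in> S then A v else B)) = (\<Prod>v\<in>S. card (A v)) * card B ^ (n - card S)"
proof -
  have "card (PiE {..<n} (\<lambda>v. if v \<in> S then A v else B)) =
      (\<Prod>v\<in>{..<n}. if v \<in> S then card (A v) else card B)"
    by (simp add: card_PiE if_distrib)
  also have "\<dots> = (\<Prod>v\<in>{..<n} \<inter> S. card (A v)) * (\<Prod>v\<in>{..<n} \<inter> - S. card B)"
    by (subst prod.If_cases) auto
  also have "{..<n} \<inter> S = S" using assms by auto
  also have "{..<n} \<inter> - S = {..<n} - S" by auto
  also have "(\<Prod>v\<in>{..<n} - S. card B) = card B ^ (n - card S)"
    using assms by (simp add: card_Diff_subset finite_subset)
  finally show ?thesis .
qed

text \<open>The nodes reachable from one endpoint of an unconnected pair form one side of a cut. The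
  cut condition is symmetric, so the smaller side can be taken.\<close>

lemma disconnected_imp_cut:
  assumes "\<not> ig_connected n F"
  obtains S where "S \<subseteq> {..<n}" "S \<noteq> {}" "S \<noteq> {..<n}" "2 * card S \<le> n"
    "\<forall>u\<in>S. \<forall>v\<in>{..<n} - S. F u \<inter> F v = {}"
proof -
  obtain u v where uv: "u < n" "v < n" "(u, v) \<notin> (ig_edges n F)\<^sup>*"
    using assms unfolding ig_connected_def by auto
  define C where "C = {w. w < n \<and> (u, w) \<in> (ig_edges n F)\<^sup>*}"
  have C: "C \<subseteq> {..<n}" "u \<in> C" "v \<notin> C" using uv by (auto simp: C_def)
  have cut: "F a \<inter> F b = {}" if "a \<in> C" "b \<in> {..<n} - C" for a b
  proof (rule ccontr)
    assume "F a \<inter> F b \<noteq> {}"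
    then have "(a, b) \<in> ig_edges n F" using that by (auto simp: C_def ig_edges_def)
    then have "b \<in> C" using that by (auto simp: C_def intro: rtrancl_into_rtrancl)
    then show False using that by auto
  qed
  have card: "card ({..<n} - C) = n - card C"
    using C by (simp add: card_Diff_subset finite_subset)
  show thesis
  proof (cases "2 * card C \<le> n")
    case True
    show thesis by (rule that[of C]) (use C uv True cut in auto)
  next
    case False
    show thesis
    proof (rule that[of "{..<n} - C"])
      show "2 * card ({..<n} - C) \<le> n" using False card by linarith
      show "\<forall>a\<in>{..<n} - C. \<forall>b\<in>{..<n} - ({..<n} - C). F a \<inter> F b = {}"
        using cut by blast
    qed (use C uv in auto)
  qed
qed

text \<open>Pad the colours used on \<open>S\<close> to a set \<open>X\<close> of exactly
  \<open>x\<close> colours, which \<open>x \<le> m\<close> permits, and sum over \<open>X\<close>: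
  nodes of \<open>S\<close> choose inside \<open>X\<close>, the others freely.\<close>

lemma card_assignments_small_union:
  assumes S: "S \<subseteq> {..<n}" and "x \<le> m"
  shows "card {F \<in> assignments n m k. card (\<Union>(F ` S)) \<le> x}
    \<le> (m choose x) * ((x choose k) ^ card S * (m choose k) ^ (n - card S))"
proof -
  define Q where "Q X = PiE {..<n} (\<lambda>v. if v \<in> S then {T. T \<subseteq> X \<and> card T = k} else ksubsets m k)" for X
  have sub: "{F \<in> assignments n m k. card (\<Union>(F ` S)) \<le> x} \<subseteq> (\<Union>X\<in>ksubsets m x. Q X)"
  proof
    fix F assume "F \<in> {F \<in> assignments n m k. card (\<Union>(F ` S)) \<le> x}"
    then have F: "F \<in> PiE {..<n} (\<lambda>_. ksubsets m k)" "card (\<Union>(F ` S)) \<le> x"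
      by (auto simp: assignments_def)
    have FS: "F v \<in> ksubsets m k" if "v < n" for v using F that by auto
    have U: "\<Union>(F ` S) \<subseteq> {..<m}" using FS S by (fastforce simp: ksubsets_def)
    obtain X where X: "\<Union>(F ` S) \<subseteq> X" "X \<subseteq> {..<m}" "card X = x"
      using exists_subset_between[OF F(2) _ U] \<open>x \<le> m\<close> by auto
    have "F \<in> Q X" using F FS X S by (auto simp: Q_def ksubsets_def PiE_iff)
    then show "F \<in> (\<Union>X\<in>ksubsets m x. Q X)" using X by (auto simp: ksubsets_def)
  qed
  have Q: "finite (Q X)" "card (Q X) = (x choose k) ^ card S * (m choose k) ^ (n - card S)"
    if "X \<in> ksubsets m x" for X
  proof -
    have X: "finite X" "card X = x" using that by (auto simp: ksubsets_def finite_subset)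
    have fin: "finite {T. T \<subseteq> X \<and> card T = k}"
      by (rule finite_subset[of _ "Pow X"]) (use X in auto)
    then show "finite (Q X)" unfolding Q_def by (intro finite_PiE) auto
    show "card (Q X) = (x choose k) ^ card S * (m choose k) ^ (n - card S)"
      unfolding Q_def by (subst card_PiE_two_blocks[OF S]) (simp add: n_subsets X card_ksubsets)
  qed
  have "card {F \<in> assignments n m k. card (\<Union>(F ` S)) \<le> x} \<le> card (\<Union>X\<in>ksubsets m x. Q X)"
    by (rule card_mono[OF _ sub]) (use Q in auto)
  also have "\<dots> \<le> (\<Sum>X\<in>ksubsets m x. card (Q X))" by (rule card_UN_le) simp
  also have "\<dots> = (m choose x) * ((x choose k) ^ card S * (m choose k) ^ (n - card S))"
    using Q by (simp add: card_ksubsets)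
  finally show ?thesis .
qed

text \<open>Group the assignments by their restriction to \<open>S\<close>. A restriction determines
  the colours, at least \<open>x\<close> in number, that every remaining node must avoid. This
  serves both for cuts and for pairs of isolated nodes.\<close>

lemma card_assignments_separated:
  assumes S: "S \<subseteq> {..<n}" and W: "\<And>F. F \<in> W \<Longrightarrow> F \<in> assignments n m k"
    and sep: "\<And>F u v. F \<in> W \<Longrightarrow> u \<in> S \<Longrightarrow> v \<in> {..<n} - S \<Longrightarrow> F u \<inter> F v = {}"
    and large: "\<And>F. F \<in> W \<Longrightarrow> x \<le> card (\<Union>(F ` S))"
  shows "card W \<le> card ((\<lambda>F. restrict F S) ` W) * ((m - x) choose k) ^ (n - card S)"
proof -
  define Q where "Q g = PiE {..<n} (\<lambda>v. if v \<in> S then {g v} else {T. T \<subseteq> {..<m} - \<Union>(g ` S) \<and> card T = k})"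
    for g :: "nat \<Rightarrow> nat set"
  define G where "G = (\<lambda>F. restrict F S) ` W"
  have "finite W" by (rule finite_subset[of _ "assignments n m k"]) (use W in auto)
  then have "finite G" by (simp add: G_def)
  have sub: "W \<subseteq> (\<Union>g\<in>G. Q g)"
  proof
    fix F assume F: "F \<in> W"
    then have "F \<in> PiE {..<n} (\<lambda>_. ksubsets m k)" using W by (auto simp: assignments_def)
    then have "F \<in> Q (restrict F S)"
      using sep[OF F] S by (auto simp: Q_def ksubsets_def PiE_iff)
    then show "F \<in> (\<Union>g\<in>G. Q g)" using F by (auto simp: G_def)
  qed
  have fin: "finite {T. T \<subseteq> {..<m} - X \<and> card T = k}" for X
    by (rule finite_subset[of _ "Pow {..<m}"]) auto
  have Qfin: "finite (Q g)" for g unfolding Q_def using fin by (intro finite_PiE) auto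
  have Qcard: "card (Q g) \<le> ((m - x) choose k) ^ (n - card S)" if "g \<in> G" for g
  proof -
    obtain F where F: "F \<in> W" "g = restrict F S" using \<open>g \<in> G\<close> by (auto simp: G_def)
    have eq: "\<Union>(g ` S) = \<Union>(F ` S)" using F by auto
    have "F v \<subseteq> {..<m}" if "v \<in> S" for v
      using W[OF F(1)] that S by (auto simp: assignments_def ksubsets_def PiE_iff)
    then have U: "\<Union>(F ` S) \<subseteq> {..<m}" by auto
    then have "card ({..<m} - \<Union>(g ` S)) = m - card (\<Union>(F ` S))"
      unfolding eq by (subst card_Diff_subset) (auto intro: finite_subset)
    also have "\<dots> \<le> m - x" using large[OF F(1)] by simp
    finally have "card ({..<m} - \<Union>(g ` S)) choose k \<le> (m - x) choose k"
      by (rule binomial_right_mono)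
    then show ?thesis
      unfolding Q_def by (subst card_PiE_two_blocks[OF S]) (simp add: n_subsets power_mono)
  qed
  have "card W \<le> card (\<Union>g\<in>G. Q g)"
    by (rule card_mono[OF _ sub]) (use Qfin \<open>finite G\<close> in auto)
  also have "\<dots> \<le> (\<Sum>g\<in>G. card (Q g))" by (rule card_UN_le) fact
  also have "\<dots> \<le> (\<Sum>g\<in>G. ((m - x) choose k) ^ (n - card S))" by (intro sum_mono Qcard)
  finally show ?thesis by (simp add: G_def)
qed

lemma card_restrict_assignments_le:
  assumes "S \<subseteq> {..<n}" "W \<subseteq> assignments n m k"
  shows "card ((\<lambda>F. restrict F S) ` W) \<le> (m choose k) ^ card S"
proof -
  have "finite S" using assms finite_subset by blast
  have "(\<lambda>F. restrict F S) ` W \<subseteq> PiE S (\<lambda>_. ksubsets m k)"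
    using assms by (fastforce simp: assignments_def)
  then have "card ((\<lambda>F. restrict F S) ` W) \<le> card (PiE S (\<lambda>_. ksubsets m k))"
    using \<open>finite S\<close> by (intro card_mono finite_PiE) auto
  then show ?thesis using \<open>finite S\<close> by (simp add: card_PiE card_ksubsets)
qed

section \<open>Comparing binomial coefficients with powers\<close>

lemma Suc_times_real_binomial_Suc:
  "real (Suc k) * real (y choose Suc k) = real (y choose k) * (real y - real k)"
\<comment> \<open>The subtraction is taken in the reals, yet the recurrence holds for
  \<open>k > y\<close> too, since both binomials vanish there.\<close>
proof (cases "k \<le> y")
  case True
  have "Suc k * (y choose Suc k) = (y choose k) * (y - k)"
    by (metis Suc_times_binomial_add binomial_absorb_comp binomial_absorption mult.commute)
  then show ?thesis using True by (metis of_nat_diff of_nat_mult)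
qed (simp add: binomial_eq_0)

text \<open>Each factor satisfies \<open>(x - i) / (m - i) \<le> x / m\<close>, and the induction
  multiplies in one such inequality, cleared of denominators. Once \<open>k\<close> exceeds
  \<open>x\<close> the left side is 0.\<close>

lemma binomial_ratio_le_power:
  assumes "x \<le> m"
  shows "real (x choose k) * real m ^ k \<le> real (m choose k) * real x ^ k"
proof (induction k)
  case (Suc k)
  show ?case
  proof (cases "k \<le> x")
    case True
    have "(real x - real k) * real m \<le> (real m - real k) * real x"
      using assms by (simp add: algebra_simps mult_left_mono)
    then have "real (x choose k) * real m ^ k * ((real x - real k) * real m)
        \<le> real (m choose k) * real x ^ k * ((real m - real k) * real x)"
      by (intro mult_mono[OF Suc.IH]) (use True assms in auto)
    moreover have "real (y choose k) * z ^ k * ((real y - real k) * z)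
        = real (Suc k) * (real (y choose Suc k) * z ^ Suc k)" for y z
      unfolding mult.assoc[symmetric] Suc_times_real_binomial_Suc by (simp add: algebra_simps)
    ultimately have "real (Suc k) * (real (x choose Suc k) * real m ^ Suc k)
        \<le> real (Suc k) * (real (m choose Suc k) * real x ^ Suc k)" by metis
    then show ?thesis by (simp only: mult_le_cancel_left_pos of_nat_0_less_iff zero_less_Suc)
  qed (simp add: binomial_eq_0)
qed simp

subsection \<open>Union bounds over cuts\<close>

lemma binomial_ratio_le:
  assumes "x \<le> m" "k \<le> m" "0 < m"
  shows "real (x choose k) / real (m choose k) \<le> (real x / real m) ^ k"
  using binomial_ratio_le_power[OF assms(1), of k] assms by (simp add: field_simps power_divide)

text \<open>This is \<open>1 - t \<le> exp (- t)\<close>; for \<open>x > m\<close> the truncated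
  difference makes the left side 0.\<close>

lemma complement_ratio_le_exp:
  assumes "0 < m"
  shows "real (m - x) / real m \<le> exp (- real x / real m)"
proof -
  have "real (m - x) / real m = max 0 (1 - real x / real m)"
    using assms by (auto simp: field_simps max_def of_nat_diff)
  also have "\<dots> \<le> exp (- real x / real m)"
    using exp_ge_add_one_self[of "- real x / real m"] by simp
  finally show ?thesis .
qed

lemma sum_by_card:
  fixes f :: "nat \<Rightarrow> real"
  shows "(\<Sum>S | S \<subseteq> {..<n} \<and> card S \<in> I. f (card S)) = (\<Sum>s\<in>I \<inter> {..n}. real (n choose s) * f s)"
proof -
  have fin: "finite {S. S \<subseteq> {..<n} \<and> card S \<in> I}"
    by (rule finite_subset[of _ "Pow {..<n}"]) auto
  have "(\<Sum>S | S \<subseteq> {..<n} \<and> card S \<in> I. f (card S)) =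
      (\<Sum>s\<in>I \<inter> {..n}. \<Sum>S | S \<in> {S. S \<subseteq> {..<n} \<and> card S \<in> I} \<and> card S = s. f (card S))"
    by (rule sum.group[symmetric]) (use fin card_mono[of "{..<n}"] in auto)
  also have "\<dots> = (\<Sum>s\<in>I \<inter> {..n}. real (n choose s) * f s)"
  proof (rule sum.cong)
    fix s assume s: "s \<in> I \<inter> {..n}"
    then have "{S. S \<in> {S. S \<subseteq> {..<n} \<and> card S \<in> I} \<and> card S = s} = ksubsets n s"
      by (auto simp: ksubsets_def)
    moreover have "card S = s" if "S \<in> ksubsets n s" for S using that by (auto simp: ksubsets_def)
    ultimately show "(\<Sum>S | S \<in> {S. S \<subseteq> {..<n} \<and> card S \<in> I} \<and> card S = s. f (card S)) =
        real (n choose s) * f s"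
      by (simp add: card_ksubsets)
  qed simp
  finally show ?thesis .
qed

text \<open>The split point \<open>x\<close> stays a parameter, chosen only in
  \<open>prob_disconnected_le_dense\<close>. The \<open>+ 1\<close> records that in the second case
  the union has strictly more than \<open>x s\<close> colours; it later absorbs a rounding
  error.\<close>

lemma prob_disconnected_le_node_cuts:
  assumes "k \<le> m" "0 < m" and x: "\<And>s. x s \<le> m"
  shows "1 - prob_connected n m k \<le> (\<Sum>s = 1..n div 2. real (n choose s) *
    (real (m choose x s) * (real (x s) / real m) ^ (k * s)
      + exp (- real k * (real (x s) + 1) * real (n - s) / real m)))"
proof -
  define N where "N = real (m choose k)"
  have N: "N > 0" using assms by (simp add: N_def)
  define \<S> where "\<S> = {S. S \<subseteq> {..<n} \<and> card S \<in> {1..n div 2}}"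
  define f where "f s = real (m choose x s) * (real (x s) / real m) ^ (k * s)
      + exp (- real k * (real (x s) + 1) * real (n - s) / real m)" for s
  define W where "W S = {F \<in> assignments n m k. \<forall>u\<in>S. \<forall>v\<in>{..<n} - S. F u \<inter> F v = {}}" for S
  have fin: "finite \<S>" unfolding \<S>_def by (rule finite_subset[of _ "Pow {..<n}"]) auto
  have W: "real (card (W S)) / N ^ n \<le> f (card S)" if "S \<in> \<S>" for S
  proof -
    define s where "s = card S"
    have S: "S \<subseteq> {..<n}" and s: "s \<le> n" using that by (auto simp: \<S>_def s_def)
    define y where "y = x s"
    have Nn: "N ^ n = N ^ s * N ^ (n - s)" using s by (simp flip: power_add)
    \<comment> \<open>With few colours the separation is dropped and only the size of the union
      counts; with many, the separation confines the nodes outside \<open>S\<close>.\<close>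
    define W1 where "W1 = {F \<in> W S. card (\<Union>(F ` S)) \<le> y}"
    define W2 where "W2 = {F \<in> W S. Suc y \<le> card (\<Union>(F ` S))}"
    have "card (W S) \<le> card W1 + card W2"
      by (rule order.trans[OF _ card_Un_le], rule card_mono)
        (auto simp: W1_def W2_def W_def)
    have "card W1 \<le> card {F \<in> assignments n m k. card (\<Union>(F ` S)) \<le> y}"
      by (rule card_mono) (auto simp: W1_def W_def)
    also have "\<dots> \<le> (m choose y) * ((y choose k) ^ s * (m choose k) ^ (n - s))"
      unfolding s_def by (rule card_assignments_small_union[OF S]) (simp add: y_def x)
    finally have "real (card W1) \<le> real (m choose y) * (real (y choose k) ^ s * N ^ (n - s))"
      unfolding N_def by (simp only: of_nat_le_iff flip: of_nat_mult of_nat_power)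
    then have "real (card W1) / N ^ n \<le> real (m choose y) * (real (y choose k) / N) ^ s"
      unfolding Nn using N by (simp add: field_simps)
    also have "\<dots> \<le> real (m choose y) * ((real y / real m) ^ k) ^ s"
      using binomial_ratio_le[of y m k] assms
      by (intro mult_left_mono power_mono) (auto simp: N_def y_def)
    finally have 1: "real (card W1) / N ^ n \<le> real (m choose y) * (real y / real m) ^ (k * s)"
      by (simp add: power_mult)
    have "card W2 \<le> card ((\<lambda>F. restrict F S) ` W2) * ((m - Suc y) choose k) ^ (n - card S)"
      by (rule card_assignments_separated[OF S]) (auto simp: W2_def W_def)
    also have "\<dots> \<le> (m choose k) ^ card S * ((m - Suc y) choose k) ^ (n - card S)"
      by (intro mult_right_mono card_restrict_assignments_le[OF S]) (auto simp: W2_def W_def)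
    finally have "real (card W2) \<le> N ^ s * real ((m - Suc y) choose k) ^ (n - s)"
      unfolding N_def s_def by (simp only: of_nat_le_iff flip: of_nat_mult of_nat_power)
    then have "real (card W2) / N ^ n \<le> (real ((m - Suc y) choose k) / N) ^ (n - s)"
      unfolding Nn using N by (simp add: field_simps)
    also have "\<dots> \<le> ((real (m - Suc y) / real m) ^ k) ^ (n - s)"
      using binomial_ratio_le[of "m - Suc y" m k] assms
      by (intro power_mono) (auto simp: N_def)
    also have "\<dots> \<le> (exp (- real (Suc y) / real m) ^ k) ^ (n - s)"
      using complement_ratio_le_exp[OF \<open>0 < m\<close>, of "Suc y"] by (intro power_mono) auto
    also have "\<dots> = exp (- real k * (real y + 1) * real (n - s) / real m)"
      by (simp add: algebra_simps flip: power_mult exp_of_nat_mult)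
    finally have 2: "real (card W2) / N ^ n \<le> exp (- real k * (real y + 1) * real (n - s) / real m)" .
    have "real (card (W S)) / N ^ n \<le> real (card W1) / N ^ n + real (card W2) / N ^ n"
      using \<open>card (W S) \<le> card W1 + card W2\<close> N
      by (simp add: divide_right_mono flip: add_divide_distrib of_nat_add)
    then show ?thesis using 1 2 by (simp add: f_def y_def s_def)
  qed
  have "{F \<in> assignments n m k. \<not> ig_connected n F} \<subseteq> (\<Union>S\<in>\<S>. W S)"
  proof
    fix F assume F: "F \<in> {F \<in> assignments n m k. \<not> ig_connected n F}"
    then have "\<not> ig_connected n F" by simp
    then obtain S where S: "S \<subseteq> {..<n}" "S \<noteq> {}" "S \<noteq> {..<n}" "2 * card S \<le> n"
      "\<forall>u\<in>S. \<forall>v\<in>{..<n} - S. F u \<inter> F v = {}"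
      by (rule disconnected_imp_cut)
    then have "card S \<ge> 1" by (metis One_nat_def Suc_leI card_gt_0_iff finite_lessThan finite_subset)
    then have "S \<in> \<S>" using S by (auto simp: \<S>_def)
    moreover have "F \<in> W S" using F S by (auto simp: W_def)
    ultimately show "F \<in> (\<Union>S\<in>\<S>. W S)" by auto
  qed
  then have "card {F \<in> assignments n m k. \<not> ig_connected n F} \<le> card (\<Union>S\<in>\<S>. W S)"
    by (rule card_mono[rotated]) (use fin in \<open>auto simp: W_def\<close>)
  also have "\<dots> \<le> (\<Sum>S\<in>\<S>. card (W S))" by (rule card_UN_le) fact
  finally have "real (card {F \<in> assignments n m k. \<not> ig_connected n F}) / N ^ n
      \<le> (\<Sum>S\<in>\<S>. real (card (W S))) / N ^ n"
    using N by (intro divide_right_mono) (simp_all flip: of_nat_sum)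
  also have "\<dots> \<le> (\<Sum>S\<in>\<S>. f (card S))"
    unfolding sum_divide_distrib by (intro sum_mono W)
  also have "\<dots> = (\<Sum>s\<in>{1..n div 2} \<inter> {..n}. real (n choose s) * f s)"
    unfolding \<S>_def by (rule sum_by_card)
  also have "{1..n div 2} \<inter> {..n} = {1..n div 2}" by auto
  finally show ?thesis
    unfolding prob_disconnected_eq[OF \<open>k \<le> m\<close>] f_def N_def .
qed

text \<open>With \<open>p = a / m \<le> 1 / 2\<close>, a random colour set stays on one side of
  \<open>A\<close> with probability at most \<open>p ^ k + (1 - p) ^ k\<close>. For
  \<open>k \<ge> 2\<close> this is at most
  \<open>1 - 2 * p * (1 - p) \<le> 1 - p \<le> exp (- p)\<close>, and the nodes choose
  independently.\<close>

lemma prob_disconnected_le_colour_cuts: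
  assumes "2 \<le> k" "k \<le> m"
  shows "1 - prob_connected n m k \<le> (\<Sum>a = 1..m div 2. real (m choose a) * exp (- real n * real a / real m))"
proof -
  define N where "N = real (m choose k)"
  have N: "N > 0" using assms by (simp add: N_def)
  have m: "m > 0" using assms by simp
  define \<A> where "\<A> = {A. A \<subseteq> {..<m} \<and> card A \<in> {1..m div 2}}"
  have fin: "finite \<A>" unfolding \<A>_def by (rule finite_subset[of _ "Pow {..<m}"]) auto
  define R where "R A = {T. T \<subseteq> A \<and> card T = k} \<union> {T. T \<subseteq> {..<m} - A \<and> card T = k}" for A
  define W where "W A = PiE {..<n} (\<lambda>_. R A)" for A
  have finR: "finite (R A)" if "A \<in> \<A>" for A
    by (rule finite_subset[of _ "Pow {..<m}"]) (use that in \<open>auto simp: R_def \<A>_def\<close>)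
  have finW: "finite (W A)" if "A \<in> \<A>" for A
    unfolding W_def using finR[OF that] by (intro finite_PiE) auto
  have W: "real (card (W A)) / N ^ n \<le> exp (- real n * real (card A) / real m)" if "A \<in> \<A>" for A
  proof -
    define a where "a = card A"
    have A: "A \<subseteq> {..<m}" "finite A" and a: "a \<le> m" "2 * a \<le> m"
      using that finite_subset by (auto simp: \<A>_def a_def)
    define p where "p = real a / real m"
    have p: "0 \<le> p" "p \<le> 1 / 2" using a m by (auto simp: p_def field_simps)
    have q: "real (m - a) / real m = 1 - p" using a m by (simp add: p_def of_nat_diff field_simps)
    have "card (R A) \<le> (a choose k) + ((m - a) choose k)"
      unfolding R_def using A
      by (intro order.trans[OF card_Un_le]) (simp add: n_subsets card_Diff_subset a_def)
    then have "real (card (R A)) / N \<le> (real (a choose k) + real ((m - a) choose k)) / N"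
      using N by (intro divide_right_mono) (simp_all flip: of_nat_add)
    also have "\<dots> = real (a choose k) / N + real ((m - a) choose k) / N"
      by (simp add: add_divide_distrib)
    also have "\<dots> \<le> (real a / real m) ^ k + (real (m - a) / real m) ^ k"
      unfolding N_def using a assms m by (intro add_mono binomial_ratio_le) auto
    also have "\<dots> = p ^ k + (1 - p) ^ k" unfolding q by (simp add: p_def)
    also have "\<dots> \<le> p ^ 2 + (1 - p) ^ 2"
      using p assms by (intro add_mono power_decreasing) auto
    also have "\<dots> = 1 - p - p * (1 - 2 * p)" by (simp add: power2_eq_square algebra_simps)
    also have "\<dots> \<le> 1 + (- p)" using p by simp
    also have "\<dots> \<le> exp (- p)" by (rule exp_ge_add_one_self)
    finally have "(real (card (R A)) / N) ^ n \<le> exp (- p) ^ n"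
      using N by (intro power_mono) auto
    then show ?thesis
      by (simp add: W_def card_PiE p_def a_def power_divide flip: exp_of_nat_mult)
  qed
  have "{F \<in> assignments n m k. \<not> ig_connected n F} \<subseteq> (\<Union>A\<in>\<A>. W A)"
  proof
    fix F assume F: "F \<in> {F \<in> assignments n m k. \<not> ig_connected n F}"
    then have Fv: "F v \<subseteq> {..<m}" "card (F v) = k" if "v < n" for v
      using that by (auto simp: assignments_def ksubsets_def PiE_iff)
    have FE: "F \<in> extensional {..<n}" using F by (auto simp: assignments_def PiE_iff)
    from F have "\<not> ig_connected n F" by simp
    then obtain S where S: "S \<subseteq> {..<n}" "S \<noteq> {}" "S \<noteq> {..<n}" "2 * card S \<le> n"
      "\<forall>u\<in>S. \<forall>v\<in>{..<n} - S. F u \<inter> F v = {}"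
      by (rule disconnected_imp_cut)
    \<comment> \<open>One side of a node cut supplies the colour cut. No colour set is empty because
      \<open>k \<ge> 2\<close>, so both \<open>U\<close> and its complement are nonempty.\<close>
    define U where "U = \<Union>(F ` S)"
    have U: "U \<subseteq> {..<m}" using Fv S(1) by (auto simp: U_def)
    obtain u v where uv: "u \<in> S" "v \<in> {..<n} - S" using S by blast
    have nonempty: "F w \<noteq> {}" if "w < n" for w using Fv(2)[OF that] assms by auto
    have U1: "U \<noteq> {}" using nonempty[of u] uv S(1) by (auto simp: U_def)
    have sep: "F w \<subseteq> {..<m} - U" if "w \<in> {..<n} - S" for w
      using S(5) that Fv(1)[of w] unfolding U_def by blast
    have U2: "{..<m} - U \<noteq> {}" using sep[of v] nonempty[of v] uv by auto
    have FR: "F \<in> PiE {..<n} (\<lambda>_. {T. T \<subseteq> U \<and> card T = k} \<union> {T. T \<subseteq> {..<m} - U \<and> card T = k})"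
    proof -
      have "F w \<subseteq> U \<or> F w \<subseteq> {..<m} - U" if "w < n" for w
        using sep[of w] that unfolding U_def by blast
      then show ?thesis using Fv(2) FE by (auto simp: PiE_iff)
    qed
    have cU: "card ({..<m} - U) = m - card U" "finite U"
      using U by (auto simp: card_Diff_subset finite_subset)
    have cU1: "card U \<ge> 1" using U1 cU(2) by (simp add: Suc_leI card_gt_0_iff)
    have cU2: "card ({..<m} - U) \<ge> 1" using U2 by (simp add: Suc_leI card_gt_0_iff)
    show "F \<in> (\<Union>A\<in>\<A>. W A)"
    \<comment> \<open>\<open>R\<close> takes the same value on \<open>U\<close> and on its
      complement, so the smaller of the two can be used.\<close>
    proof (cases "2 * card U \<le> m")
      case True
      then have "U \<in> \<A>" using U cU1 by (auto simp: \<A>_def)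
      moreover have "F \<in> W U" using FR by (simp add: W_def R_def)
      ultimately show ?thesis by blast
    next
      case False
      then have "{..<m} - U \<in> \<A>" using cU cU2 by (auto simp: \<A>_def)
      moreover have "{..<m} - ({..<m} - U) = U" using U by auto
      then have "F \<in> W ({..<m} - U)" using FR by (simp add: W_def R_def Un_commute)
      ultimately show ?thesis by blast
    qed
  qed
  then have "card {F \<in> assignments n m k. \<not> ig_connected n F} \<le> card (\<Union>A\<in>\<A>. W A)"
    by (rule card_mono[rotated]) (use fin finW in auto)
  also have "\<dots> \<le> (\<Sum>A\<in>\<A>. card (W A))" by (rule card_UN_le) fact
  finally have "real (card {F \<in> assignments n m k. \<not> ig_connected n F}) / N ^ n
      \<le> (\<Sum>A\<in>\<A>. real (card (W A))) / N ^ n"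
    using N by (intro divide_right_mono) (simp_all flip: of_nat_sum)
  also have "\<dots> \<le> (\<Sum>A\<in>\<A>. exp (- real n * real (card A) / real m))"
    unfolding sum_divide_distrib by (intro sum_mono W)
  also have "\<dots> = (\<Sum>a\<in>{1..m div 2} \<inter> {..m}. real (m choose a) * exp (- real n * real a / real m))"
    unfolding \<A>_def by (rule sum_by_card)
  also have "{1..m div 2} \<inter> {..m} = {1..m div 2}" by auto
  finally show ?thesis
    unfolding prob_disconnected_eq[OF \<open>k \<le> m\<close>] N_def .
qed

subsection \<open>Isolated nodes\<close>

text \<open>Passing from \<open>j\<close> to \<open>Suc j\<close> multiplies the sides by factors
  with \<open>(a - j) * (a + 2 * d - j) \<le> (a + d - j)\<^sup>2\<close>, an instance of the
  arithmetic-geometric mean inequality.\<close>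

lemma binomial_log_concave:
  "real (a choose j) * real ((a + 2 * d) choose j) \<le> real ((a + d) choose j) ^ 2"
proof (induction j)
  case (Suc j)
  show ?case
  proof (cases "j \<le> a")
    case True
    define A B C where "A = real (a choose j)" and "B = real ((a + 2 * d) choose j)"
      and "C = real ((a + d) choose j)"
    define x where "x = real a - real j"
    have "x * (x + 2 * real d) \<le> (x + real d) ^ 2"
      by (simp add: power2_eq_square algebra_simps)
    then have "(A * B) * (x * (x + 2 * real d)) \<le> C ^ 2 * (x + real d) ^ 2"
      by (intro mult_mono) (use Suc.IH True in \<open>auto simp: A_def B_def C_def x_def\<close>)
    then have "(A * (real a - real j)) * (B * (real (a + 2 * d) - real j))
        \<le> (C * (real (a + d) - real j)) ^ 2"
      unfolding power_mult_distrib by (simp add: x_def algebra_simps)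
    then have "real (Suc j) ^ 2 * (real (a choose Suc j) * real ((a + 2 * d) choose Suc j))
        \<le> real (Suc j) ^ 2 * real ((a + d) choose Suc j) ^ 2"
      unfolding A_def B_def C_def Suc_times_real_binomial_Suc[symmetric]
      by (simp add: power2_eq_square mult_ac)
    then show ?thesis by (simp only: mult_le_cancel_left_pos zero_less_power of_nat_0_less_iff zero_less_Suc)
  qed (simp add: binomial_eq_0)
qed simp

text \<open>A \<open>k\<close>-set either avoids a fixed \<open>j\<close>-set or shares one of its
  \<open>j\<close> colours, whence a union bound. The induction removes these colours one at a time
  by Pascal's rule.\<close>

lemma binomial_le_binomial_diff:
  assumes "k \<ge> 1" "j \<le> m"
  shows "m choose k \<le> ((m - j) choose k) + j * ((m - 1) choose (k - 1))"
  using assms(2)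
proof (induction j)
  case (Suc j)
  have "(m - j) choose k = ((m - Suc j) choose k) + ((m - Suc j) choose (k - 1))"
    using Suc.prems assms(1) binomial_Suc_Suc[of "m - Suc j" "k - 1"]
    by (simp add: Suc_diff_Suc)
  moreover have "(m - Suc j) choose (k - 1) \<le> (m - 1) choose (k - 1)"
    by (rule binomial_right_mono) simp
  ultimately show ?case using Suc by simp
qed simp

text \<open>The ratio is the probability that two random colour sets are disjoint, and
  \<open>k ^ 2 / m\<close> is their expected number of common colours.\<close>

lemma disjoint_ratio_ge:
  assumes "1 \<le> k" "k \<le> m"
  shows "real ((m - k) choose k) / real (m choose k) \<ge> 1 - real k ^ 2 / real m"
proof -
  have "k * (m choose k) = m * ((m - 1) choose (k - 1))"
    using assms by (intro times_binomial_minus1_eq) simp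
  then have "real ((m - 1) choose (k - 1)) = real k * real (m choose k) / real m"
    using assms by (simp add: field_simps flip: of_nat_mult)
  moreover have "real (m choose k) \<le> real ((m - k) choose k) + real k * real ((m - 1) choose (k - 1))"
    using binomial_le_binomial_diff[OF assms] by (simp only: of_nat_le_iff flip: of_nat_mult of_nat_add)
  moreover have "real (m choose k) > 0" using assms by simp
  ultimately show ?thesis by (simp add: field_simps power2_eq_square)
qed

text \<open>Chebyshev's inequality in counting form: every outcome with \<open>X w = 0\<close>
  contributes \<open>\<mu>\<^sup>2\<close> to the sum of squared deviations.\<close>

lemma second_moment_count:
  fixes X :: "'a \<Rightarrow> real"
  assumes "finite \<Omega>" and "sum X \<Omega> = \<mu> * real (card \<Omega>)"
  shows "real (card {w \<in> \<Omega>. X w = 0}) * \<mu>\<^sup>2 \<le> (\<Sum>w\<in>\<Omega>. (X w)\<^sup>2) - \<mu>\<^sup>2 * real (card \<Omega>)"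
proof -
  have "real (card {w \<in> \<Omega>. X w = 0}) * \<mu>\<^sup>2 = (\<Sum>w | w \<in> \<Omega> \<and> X w = 0. (X w - \<mu>)\<^sup>2)"
    by simp
  also have "\<dots> \<le> (\<Sum>w\<in>\<Omega>. (X w - \<mu>)\<^sup>2)"
    using assms(1) by (intro sum_mono2) auto
  also have "\<dots> = (\<Sum>w\<in>\<Omega>. (X w)\<^sup>2) - 2 * \<mu> * sum X \<Omega> + \<mu>\<^sup>2 * real (card \<Omega>)"
  proof -
    have "(X w - \<mu>)\<^sup>2 = (X w)\<^sup>2 - 2 * \<mu> * X w + \<mu>\<^sup>2" for w
      by (simp add: power2_diff)
    then show ?thesis by (simp add: sum.distrib sum_subtractf flip: sum_distrib_left)
  qed
  finally show ?thesis using assms(2) by (simp add: power2_eq_square)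
qed

definition isolated_assignments :: "nat \<Rightarrow> nat \<Rightarrow> nat \<Rightarrow> nat \<Rightarrow> (nat \<Rightarrow> nat set) set" where
  "isolated_assignments n m k v = {F \<in> assignments n m k. \<forall>u\<in>{..<n} - {v}. F u \<inter> F v = {}}"

lemma finite_isolated_assignments [simp]: "finite (isolated_assignments n m k v)"
  unfolding isolated_assignments_def by simp

text \<open>The colour set \<open>T\<close> of \<open>v\<close> partitions these assignments. An
  exact count is wanted, because it yields the mean in the second moment argument.\<close>

lemma card_isolated_assignments:
  assumes "v < n"
  shows "card (isolated_assignments n m k v) = (m choose k) * ((m - k) choose k) ^ (n - 1)"
proof -
  define Q where "Q T = PiE {..<n} (\<lambda>u. if u \<in> {v} then {T} else {T'. T' \<subseteq> {..<m} - T \<and> card T' = k})"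
    for T :: "nat set"
  have "isolated_assignments n m k v = (\<Union>T\<in>ksubsets m k. Q T)"
  proof (intro set_eqI iffI)
    fix F assume F: "F \<in> isolated_assignments n m k v"
    then have "F \<in> Q (F v)" "F v \<in> ksubsets m k"
      using assms by (auto simp: Q_def isolated_assignments_def assignments_def PiE_iff ksubsets_def)
    then show "F \<in> (\<Union>T\<in>ksubsets m k. Q T)" by blast
  next
    fix F assume "F \<in> (\<Union>T\<in>ksubsets m k. Q T)"
    then obtain T where T: "T \<in> ksubsets m k" "F \<in> Q T" by blast
    have "F v \<in> {T}" using PiE_mem[OF T(2)[unfolded Q_def], of v] assms by simp
    then have "F v = T" by simp
    moreover have "F u \<subseteq> {..<m} - T \<and> card (F u) = k" if "u < n" "u \<noteq> v" for u
      using PiE_mem[OF T(2)[unfolded Q_def], of u] that by simp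
    moreover have "F \<in> extensional {..<n}" using T(2) by (auto simp: Q_def PiE_iff)
    ultimately show "F \<in> isolated_assignments n m k v"
      using T(1) assms
      by (fastforce simp: isolated_assignments_def assignments_def PiE_iff ksubsets_def)
  qed
  moreover have "finite (Q T)" for T
    unfolding Q_def by (intro finite_PiE) (auto intro: finite_subset[of _ "Pow {..<m}"])
  moreover have "Q T \<inter> Q T' = {}" if "T \<noteq> T'" for T T'
    proof -
    have "F v = T" if "F \<in> Q T" for F T
      using PiE_mem[OF that[unfolded Q_def], of v] assms by simp
    then show ?thesis using that by blast
  qed
  ultimately have "card (isolated_assignments n m k v) = (\<Sum>T\<in>ksubsets m k. card (Q T))"
    by (simp add: card_UN_disjoint)
  also have "\<dots> = (\<Sum>T\<in>ksubsets m k. ((m - k) choose k) ^ (n - 1))"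
  proof (rule sum.cong[OF refl])
    fix T assume "T \<in> ksubsets m k"
    then have "card ({..<m} - T) = m - k"
      by (auto simp: ksubsets_def card_Diff_subset finite_subset)
    moreover have "{v} \<subseteq> {..<n}" using assms by simp
    ultimately show "card (Q T) = ((m - k) choose k) ^ (n - 1)"
      unfolding Q_def by (subst card_PiE_two_blocks) (auto simp: n_subsets)
  qed
  finally show ?thesis by (simp add: card_ksubsets)
qed

text \<open>Two isolated nodes have disjoint colour sets, so the others avoid \<open>2 * k\<close>
  colours. Admitting all pairs of colour sets for \<open>u\<close> and \<open>v\<close> costs a
  factor that is harmless when two colour sets are almost surely disjoint.\<close>

lemma card_isolated_pair_le:
  assumes "u < n" "v < n" "u \<noteq> v"
  shows "card (isolated_assignments n m k u \<inter> isolated_assignments n m k v)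
    \<le> (m choose k)\<^sup>2 * ((m - 2 * k) choose k) ^ (n - 2)"
proof -
  let ?W = "isolated_assignments n m k u \<inter> isolated_assignments n m k v"
  have S: "{u, v} \<subseteq> {..<n}" and card: "card {u, v} = 2" using assms by auto
  have W: "F w \<inter> F u = {}" if "F \<in> ?W" "w < n" "w \<noteq> u" for F w
    using that by (auto simp: isolated_assignments_def)
  have W': "F w \<inter> F v = {}" if "F \<in> ?W" "w < n" "w \<noteq> v" for F w
    using that by (auto simp: isolated_assignments_def)
  have "card ?W \<le> card ((\<lambda>F. restrict F {u, v}) ` ?W) * ((m - 2 * k) choose k) ^ (n - card {u, v})"
  proof (rule card_assignments_separated[OF S])
    show "F \<in> assignments n m k" if "F \<in> ?W" for F using that by (simp add: isolated_assignments_def)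
    show "F a \<inter> F b = {}" if "F \<in> ?W" "a \<in> {u, v}" "b \<in> {..<n} - {u, v}" for F a b
      using W[of F b] W'[of F b] that by auto
    show "2 * k \<le> card (\<Union> (F ` {u, v}))" if F: "F \<in> ?W" for F
    proof -
      have "F u \<in> ksubsets m k" "F v \<in> ksubsets m k"
        using F assms by (auto simp: isolated_assignments_def assignments_def PiE_iff)
      then have "finite (F u)" "finite (F v)" "card (F u) = k" "card (F v) = k"
        by (auto simp: ksubsets_def finite_subset)
      then show ?thesis using W'[OF F assms(1,3)] by (simp add: card_Un_disjoint)
    qed
  qed
  also have "\<dots> \<le> (m choose k) ^ card {u, v} * ((m - 2 * k) choose k) ^ (n - card {u, v})"
    by (intro mult_right_mono card_restrict_assignments_le[OF S]) (auto simp: isolated_assignments_def)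
  finally show ?thesis unfolding card .
qed

lemma isolated_imp_disconnected:
  assumes "v < n" "n \<ge> 2" "F \<in> isolated_assignments n m k v"
  shows "\<not> ig_connected n F"
proof
  assume con: "ig_connected n F"
  obtain u where u: "u < n" "u \<noteq> v"
    using assms by (metis One_nat_def less_2_cases_iff less_le_trans zero_neq_one)
  then have "(u, v) \<in> (ig_edges n F)\<^sup>*" using con assms by (auto simp: ig_connected_def)
  then obtain w where "(w, v) \<in> ig_edges n F" using u by (metis rtranclE)
  then show False using assms by (auto simp: ig_edges_def isolated_assignments_def)
qed

text \<open>The number \<open>X\<close> of isolated nodes has mean
  \<open>\<mu> = n * q ^ (n - 1)\<close> and second moment at most
  \<open>\<mu> + n\<^sup>2 * q ^ (2 * (n - 2))\<close>. A connected graph has \<open>X = 0\<close>,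
  so Chebyshev applies; \<open>1 / q\<^sup>2\<close> comes from comparing the exponents
  \<open>2 * (n - 2)\<close> and \<open>2 * (n - 1)\<close>.\<close>

lemma prob_connected_le_second_moment:
  assumes "k \<le> m" "n \<ge> 2" and q: "q = real ((m - k) choose k) / real (m choose k)" "q > 0"
  shows "prob_connected n m k \<le> 1 / (real n * q ^ (n - 1)) + 1 / q\<^sup>2 - 1"
proof -
  define N where "N = real (m choose k)"
  have N: "N > 0" using assms by (simp add: N_def)
  define \<Omega> where "\<Omega> = assignments n m k"
  define I where "I = isolated_assignments n m k"
  define X where "X F = (\<Sum>v<n. indicator (I v) F :: real)" for F
  define \<mu> where "\<mu> = real n * q ^ (n - 1)"
  have \<mu>: "\<mu> > 0" using assms by (simp add: \<mu>_def)
  have \<Omega>: "finite \<Omega>" "real (card \<Omega>) = N ^ n" by (simp_all add: \<Omega>_def card_assignments N_def)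
  have sub: "I v \<subseteq> \<Omega>" for v by (auto simp: I_def \<Omega>_def isolated_assignments_def)
  have ind: "(\<Sum>F\<in>\<Omega>. indicator A F :: real) = real (card A)" if "A \<subseteq> \<Omega>" for A
    using that \<Omega>(1) by (simp add: indicator_def sum.If_cases Int_absorb1)
  have D: "real ((m - k) choose k) = q * N" using q(1) N by (simp add: N_def)
  \<comment> \<open>Log-concavity at \<open>m - 2 * k\<close>, \<open>m - k\<close>,
    \<open>m\<close> gives this if \<open>2 * k \<le> m\<close>. Otherwise the truncated difference
    is 0 and the binomial vanishes, as \<open>k > 0\<close>.\<close>
  have D2: "real ((m - 2 * k) choose k) \<le> q\<^sup>2 * N"
  proof (cases "2 * k \<le> m")
    case True
    then have "real ((m - 2 * k) choose k) * N \<le> (q * N)\<^sup>2"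
      using binomial_log_concave[of "m - 2 * k" k k] by (simp add: N_def flip: D[unfolded N_def])
    then show ?thesis using N by (simp add: power2_eq_square mult.assoc)
  next
    case False
    have "k > 0" using False assms by auto
    then show ?thesis using False N by (simp add: binomial_eq_0)
  qed
  have cardI: "real (card (I v)) = q ^ (n - 1) * N ^ n" if "v < n" for v
  proof -
    have "real (card (I v)) = N * (q * N) ^ (n - 1)"
      unfolding D[symmetric] by (simp add: I_def N_def card_isolated_assignments[OF that])
    also have "\<dots> = q ^ (n - 1) * N ^ Suc (n - 1)" by (simp add: power_mult_distrib)
    finally show ?thesis using assms(2) by simp
  qed
  have cardII: "real (card (I u \<inter> I v)) \<le> q ^ (2 * (n - 2)) * N ^ n" if "u < n" "v < n" "u \<noteq> v" for u v
  proof -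
    have "real (card (I u \<inter> I v)) \<le> real ((m choose k)\<^sup>2 * ((m - 2 * k) choose k) ^ (n - 2))"
      unfolding I_def of_nat_le_iff using card_isolated_pair_le[OF that] .
    also have "\<dots> \<le> N\<^sup>2 * (q\<^sup>2 * N) ^ (n - 2)"
      using D2 by (auto simp: N_def intro!: mult_left_mono power_mono)
    also have "\<dots> = q ^ (2 * (n - 2)) * N ^ (2 + (n - 2))"
      by (simp only: power_mult_distrib power_add power_mult mult_ac)
    also have "2 + (n - 2) = n" using assms(2) by simp
    finally show ?thesis .
  qed
  have sumX: "sum X \<Omega> = \<mu> * real (card \<Omega>)"
  proof -
    have "sum X \<Omega> = (\<Sum>v<n. \<Sum>F\<in>\<Omega>. indicator (I v) F)" unfolding X_def by (rule sum.swap)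
    also have "\<dots> = (\<Sum>v<n. q ^ (n - 1) * N ^ n)" using ind[OF sub] cardI by simp
    finally show ?thesis by (simp add: \<mu>_def \<Omega>)
  qed
  have sumX2: "(\<Sum>F\<in>\<Omega>. (X F)\<^sup>2) \<le> \<mu> * N ^ n + (real n)\<^sup>2 * (q ^ (2 * (n - 2)) * N ^ n)"
  proof -
    have "(X F)\<^sup>2 = (\<Sum>u<n. \<Sum>v<n. indicator (I u \<inter> I v) F)" for F
      unfolding X_def power2_eq_square sum_product by (simp add: indicator_inter_arith)
    then have "(\<Sum>F\<in>\<Omega>. (X F)\<^sup>2) = (\<Sum>F\<in>\<Omega>. \<Sum>u<n. \<Sum>v<n. indicator (I u \<inter> I v) F)" by simp
    also have "\<dots> = (\<Sum>u<n. \<Sum>F\<in>\<Omega>. \<Sum>v<n. indicator (I u \<inter> I v) F)" by (rule sum.swap)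
    also have "\<dots> = (\<Sum>u<n. \<Sum>v<n. \<Sum>F\<in>\<Omega>. indicator (I u \<inter> I v) F)"
      by (intro sum.cong refl sum.swap)
    also have "\<dots> = (\<Sum>u<n. \<Sum>v<n. real (card (I u \<inter> I v)))"
      using sub by (intro sum.cong refl ind) blast
    \<comment> \<open>The nonnegative pair bound is added on the diagonal too, so that it is summed
      over all \<open>n\<^sup>2\<close> pairs.\<close>
    also have "\<dots> \<le> (\<Sum>u<n. \<Sum>v<n. (if v = u then q ^ (n - 1) * N ^ n else 0) + q ^ (2 * (n - 2)) * N ^ n)"
    proof (intro sum_mono)
      fix u v assume "u \<in> {..<n}" "v \<in> {..<n}"
      then show "real (card (I u \<inter> I v)) \<le> (if v = u then q ^ (n - 1) * N ^ n else 0) + q ^ (2 * (n - 2)) * N ^ n"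
        using cardI[of u] cardII[of u v] N q(2) by auto
    qed
    also have "\<dots> = real n * (q ^ (n - 1) * N ^ n) + real n * (real n * (q ^ (2 * (n - 2)) * N ^ n))"
      by (simp add: sum.distrib distrib_left)
    finally show ?thesis by (simp add: \<mu>_def power2_eq_square mult_ac)
  qed
  define Z where "Z = {F \<in> \<Omega>. X F = 0}"
  have "{F \<in> \<Omega>. ig_connected n F} \<subseteq> Z"
  proof
    fix F assume "F \<in> {F \<in> \<Omega>. ig_connected n F}"
    then have F: "F \<in> \<Omega>" and "F \<notin> I v" if "v < n" for v
      using isolated_imp_disconnected[OF _ assms(2)] that by (auto simp: I_def)
    then have "X F = 0" by (simp add: X_def)
    then show "F \<in> Z" using F[of 0] assms(2) by (simp add: Z_def)
  qed
  then have "card {F \<in> \<Omega>. ig_connected n F} \<le> card Z" using \<Omega> by (intro card_mono) (auto simp: Z_def)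
  then have "prob_connected n m k \<le> real (card Z) / N ^ n"
    unfolding prob_connected_def using \<Omega>(2) N
    by (simp add: \<Omega>_def divide_right_mono)
  also have "\<dots> \<le> 1 / \<mu> + (real n)\<^sup>2 * q ^ (2 * (n - 2)) / \<mu>\<^sup>2 - 1"
  proof -
    have "real (card Z) * \<mu>\<^sup>2 \<le> \<mu> * N ^ n + (real n)\<^sup>2 * (q ^ (2 * (n - 2)) * N ^ n) - \<mu>\<^sup>2 * N ^ n"
      using second_moment_count[OF \<Omega>(1) sumX] sumX2 unfolding Z_def \<Omega>(2) by linarith
    also have "\<dots> = (1 / \<mu> + (real n)\<^sup>2 * q ^ (2 * (n - 2)) / \<mu>\<^sup>2 - 1) * N ^ n * \<mu>\<^sup>2"
      using \<mu> by (simp add: field_simps power2_eq_square)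
    finally have "real (card Z) \<le> (1 / \<mu> + (real n)\<^sup>2 * q ^ (2 * (n - 2)) / \<mu>\<^sup>2 - 1) * N ^ n"
      using \<mu> by simp
    then show ?thesis using N by (simp add: pos_divide_le_eq)
  qed
  also have "(real n)\<^sup>2 * q ^ (2 * (n - 2)) / \<mu>\<^sup>2 = 1 / q\<^sup>2"
  proof -
    obtain j where j: "n = Suc (Suc j)" using assms(2) by (metis Suc_le_D numeral_2_eq_2 le_Suc_ex add_Suc)
    have "\<mu>\<^sup>2 = ((real n)\<^sup>2 * q ^ (2 * (n - 2))) * q\<^sup>2"
      by (simp add: \<mu>_def j power_mult_distrib power_even_eq del: of_nat_Suc)
    moreover have "(real n)\<^sup>2 * q ^ (2 * (n - 2)) \<noteq> 0" using q(2) assms(2) by simp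
    ultimately show ?thesis by simp
  qed
  finally show ?thesis by (simp add: \<mu>_def)
qed

subsection \<open>Estimates for cuts by node sets\<close>

text \<open>The left side is a single term of the expansion of \<open>(1 + x / m) ^ m\<close>. For
  \<open>x > 0\<close> this is the familiar bound \<open>(e * m / x) ^ x\<close> on the binomial
  coefficient.\<close>

lemma binomial_times_ratio_power_le_exp:
  assumes "x \<le> m" "0 < m"
  shows "real (m choose x) * (real x / real m) ^ x \<le> exp (real x)"
proof -
  have "real (m choose x) * (real x / real m) ^ x \<le> (\<Sum>i\<le>m. real (m choose i) * (real x / real m) ^ i * 1 ^ (m - i))"
    using member_le_sum[of x "{..m}" "\<lambda>i. real (m choose i) * (real x / real m) ^ i * 1 ^ (m - i)"] assms by simp
  also have "\<dots> = (real x / real m + 1) ^ m" by (simp only: binomial_ring)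
  also have "\<dots> \<le> exp (real x / real m) ^ m"
    using exp_ge_add_one_self[of "real x / real m"] by (intro power_mono) (auto simp: add.commute)
  also have "\<dots> = exp (real x)" using assms by (simp flip: exp_of_nat_mult)
  finally show ?thesis .
qed

lemma sum_powers_le:
  fixes A :: real
  assumes "0 \<le> A" "A \<le> 1 / 2"
  shows "(\<Sum>s = 1..M. A ^ s) \<le> 2 * A"
proof -
  \<comment> \<open>The subtracted term carries the induction: \<open>A \<le> 1 / 2\<close> gives
    \<open>A ^ Suc M + 2 * A ^ Suc (Suc M) \<le> 2 * A ^ Suc M\<close>.\<close>
  have "(\<Sum>s = 1..M. A ^ s) \<le> 2 * A - 2 * A ^ Suc M"
  proof (induction M)
    case (Suc M)
    have "A ^ Suc M * (2 * A) \<le> A ^ Suc M * 1" using assms by (intro mult_left_mono) auto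
    then show ?case using Suc by (simp add: algebra_simps)
  qed simp
  also have "\<dots> \<le> 2 * A" using assms by simp
  finally show ?thesis .
qed

text \<open>After \<open>(x / m) ^ x\<close> has paid for \<open>m choose x\<close> up to
  \<open>exp x\<close>, at least \<open>\<delta> * k * s\<close> factors \<open>x / m\<close> are
  left. One per node pays for the choice of \<open>S\<close>, by \<open>n \<le> m\<close>. The rest,
  each at most \<open>exp (- 2 / \<delta>)\<close>, yield about \<open>exp (- 2 * k * s)\<close>,
  which beats \<open>exp x \<le> exp (k * s)\<close>.\<close>

lemma small_union_term_le:
  fixes \<delta> :: real
  assumes \<delta>: "0 < \<delta>" "\<delta> < 1" and s: "1 \<le> s" "s \<le> n" and "n \<le> m" "1 \<le> \<delta> * real k"
    and x: "real x \<le> (1 - \<delta>) * real k * real s" "real x \<le> exp (- 2 / \<delta>) * real m"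
  shows "real (n choose s) * (real (m choose x) * (real x / real m) ^ (k * s))
    \<le> exp (1 + ln (real k) - real k + 2 / \<delta>) ^ s"
proof -
  have k: "k > 0" using assms by (cases k) auto
  have m: "m > 0" using assms by linarith
  define K where "K = real k * real s"
  have K: "K > 0" using k s by (simp add: K_def)
  \<comment> \<open>Both caps on \<open>x / m\<close> are kept: the constant one makes
    \<open>ln r \<le> - 2 / \<delta>\<close>, and \<open>r \<le> K / m\<close> with
    \<open>n \<le> m\<close> bounds \<open>n / s\<close> by \<open>k / r\<close>.\<close>
  define r where "r = min (exp (- 2 / \<delta>)) (K / real m)"
  have r0: "r > 0" using K m by (simp add: r_def)
  have rle: "r \<le> exp (- 2 / \<delta>)" "r \<le> K / real m" by (simp_all add: r_def)
  have "ln r \<le> ln (exp (- 2 / \<delta>))" using r0 rle by (subst ln_le_cancel_iff) auto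
  then have lnr: "ln r \<le> - 2 / \<delta>" by simp
  then have lnr0: "ln r \<le> 0" using \<delta> by (smt (verit) divide_neg_pos)
  have "(1 - \<delta>) * K \<le> 1 * K" using \<delta> K by (intro mult_right_mono) auto
  then have xK: "real x \<le> K" using x(1) by (simp add: K_def mult.assoc)
  then have xk: "x \<le> k * s" unfolding K_def by (metis of_nat_le_iff of_nat_mult)
  have "exp (- 2 / \<delta>) < 1" using \<delta> by simp
  then have "exp (- 2 / \<delta>) * real m \<le> real m" by (simp add: mult_left_le_one_le)
  then have xm: "x \<le> m" using x(2) by linarith
  have xr: "real x / real m \<le> r" using xK x(2) m by (simp add: r_def field_simps)
  have "real (m choose x) * (real x / real m) ^ (k * s)
      = real (m choose x) * (real x / real m) ^ x * (real x / real m) ^ (k * s - x)"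
    using xk by (simp flip: power_add)
  also have "\<dots> \<le> exp (real x) * r ^ (k * s - x)"
    using xr by (intro mult_mono binomial_times_ratio_power_le_exp xm m power_mono) auto
  also have "r ^ (k * s - x) = exp ((K - real x) * ln r)"
  proof -
    have "r ^ (k * s - x) = exp (ln r) ^ (k * s - x)" using r0 by simp
    also have "\<dots> = exp (real (k * s - x) * ln r)" by (simp flip: exp_of_nat_mult)
    finally show ?thesis using xk by (simp add: K_def of_nat_diff)
  qed
  also have "exp (real x) * exp ((K - real x) * ln r) = exp (real x * (1 - ln r) + K * ln r)"
    by (simp add: algebra_simps flip: exp_add)
  \<comment> \<open>The exponent increases with \<open>x\<close> because
    \<open>ln r \<le> 0\<close>, so \<open>x\<close> is replaced by its upper bound.\<close>
  also have "\<dots> \<le> exp (((1 - \<delta>) * K) * (1 - ln r) + K * ln r)"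
    using x(1) lnr0 by (auto simp: K_def mult.assoc intro!: mult_right_mono)
  finally have 1: "real (m choose x) * (real x / real m) ^ (k * s)
      \<le> exp ((1 - \<delta>) * K * (1 - ln r) + K * ln r)" .
  have "real (n choose s) * (real s / real n) ^ s \<le> exp (real s)"
    using s by (intro binomial_times_ratio_power_le_exp) auto
  then have "real (n choose s) \<le> exp (real s) * (real n / real s) ^ s"
    using s by (simp add: field_simps)
  also have "\<dots> \<le> exp (real s) * (real k / r) ^ s"
  proof -
    have "r * real n \<le> (K / real m) * real m"
      using rle(2) assms r0 K by (intro mult_mono) auto
    then have "real n / real s \<le> real k / r"
      using s r0 m by (simp add: K_def field_simps)
    then show ?thesis by (intro mult_left_mono power_mono) auto
  qed
  also have "(real k / r) ^ s = exp (real s * (ln (real k) - ln r))"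
  proof -
    have "real k / r = exp (ln (real k) - ln r)" using k r0 by (simp add: exp_diff)
    then show ?thesis by (simp flip: exp_of_nat_mult)
  qed
  also have "exp (real s) * \<dots> = exp (real s * (1 + ln (real k) - ln r))"
    by (simp add: algebra_simps flip: exp_add)
  finally have 2: "real (n choose s) \<le> exp (real s * (1 + ln (real k) - ln r))" .
  have "real (n choose s) * (real (m choose x) * (real x / real m) ^ (k * s))
      \<le> exp (real s * (1 + ln (real k) - ln r)) * exp ((1 - \<delta>) * K * (1 - ln r) + K * ln r)"
    using 1 2 by (intro mult_mono) auto
  also have "\<dots> = exp (real s * (1 + ln (real k) + (1 - \<delta>) * real k + (\<delta> * real k - 1) * ln r))"
    by (simp add: K_def algebra_simps flip: exp_add)
  also have "\<dots> \<le> exp (real s * (1 + ln (real k) - real k + 2 / \<delta>))"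
  proof -
    \<comment> \<open>The assumption \<open>1 \<le> \<delta> * k\<close> makes the coefficient of
      \<open>ln r\<close> nonnegative; the \<open>- 1\<close> in it comes from
      \<open>n choose s\<close>.\<close>
    have "(\<delta> * real k - 1) * ln r \<le> (\<delta> * real k - 1) * (- 2 / \<delta>)"
      using lnr assms by (intro mult_left_mono) auto
    also have "\<dots> = - 2 * real k + 2 / \<delta>" using \<delta> by (simp add: field_simps)
    finally have "(\<delta> * real k - 1) * ln r \<le> - 2 * real k + 2 / \<delta>" .
    moreover have "(1 - \<delta>) * real k \<le> real k" using \<delta> by (simp add: mult_left_le_one_le)
    ultimately have "1 + ln (real k) + (1 - \<delta>) * real k + (\<delta> * real k - 1) * ln r
        \<le> 1 + ln (real k) - real k + 2 / \<delta>" by linarith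
    then show ?thesis by (simp add: mult_left_mono)
  qed
  also have "\<dots> = exp (1 + ln (real k) - real k + 2 / \<delta>) ^ s"
    by (simp flip: exp_of_nat_mult)
  finally show ?thesis .
qed

text \<open>There is one summand for each entry of the minimum. If \<open>c * m \<le> y\<close>,
  then \<open>n - s \<ge> n / 2\<close> gives the first. Otherwise, with \<open>t = s / n\<close>,
  density makes each node of \<open>S\<close> contribute
  \<open>(1 - \<delta>) * (1 - t) * (1 + \<epsilon>) * ln n\<close> to the exponent, against
  \<open>1 - ln t\<close> for the choice of \<open>S\<close>.\<close>

lemma large_union_term_le:
  fixes \<epsilon> \<delta> c y :: real
  assumes \<epsilon>: "0 < \<epsilon>" "\<epsilon> \<le> 1" and \<delta>: "\<delta> = \<epsilon> / 8" and "c > 0" and s: "1 \<le> s" "2 * s \<le> n"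
    and "0 < m" and dens: "(1 + \<epsilon>) * real m * ln (real n) \<le> real k ^ 2 * real n"
    and y: "min ((1 - \<delta>) * real k * real s) (c * real m) \<le> y"
  shows "real (n choose s) * exp (- real k * y * real (n - s) / real m)
    \<le> real (n choose s) * exp (- real k * c * real n / 2) + exp (1 - ln \<delta> - \<epsilon> / 4 * ln (real n)) ^ s"
proof (cases "c * real m \<le> y")
  case True
  have "0 \<le> y" using True assms by (smt (verit) mult_nonneg_nonneg of_nat_0_le_iff)
  then have "c * (real n / 2) \<le> (y / real m) * real (n - s)"
    using True assms by (intro mult_mono) (auto simp: field_simps of_nat_diff)
  then have "real k * (c * (real n / 2)) \<le> real k * ((y / real m) * real (n - s))"
    by (rule mult_left_mono) simp
  then have "exp (- real k * y * real (n - s) / real m) \<le> exp (- real k * c * real n / 2)" by simp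
  then show ?thesis by (intro add_increasing2 mult_left_mono) auto
next
  case False
  then have y: "(1 - \<delta>) * real k * real s \<le> y" using y by linarith
  define L where "L = ln (real n)"
  define t where "t = real s / real n"
  have n: "n \<ge> 2" using s by simp
  have L: "L \<ge> 0" using n by (simp add: L_def)
  have t: "0 < t" "t \<le> 1 / 2" using s n by (auto simp: t_def field_simps)
  have nt: "real (n - s) = (1 - t) * real n" using s n by (simp add: t_def of_nat_diff field_simps)
  have \<delta>0: "0 < \<delta>" "\<delta> \<le> 1 / 8" using \<epsilon> \<delta> by auto
  have k: "(1 + \<epsilon>) * L \<le> real k ^ 2 * real n / real m"
    using dens assms by (simp add: L_def field_simps)
  have "(1 - \<delta>) * real k * real s * (real k * (real (n - s) / real m))
      \<le> y * (real k * (real (n - s) / real m))"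
    using y by (intro mult_right_mono) auto
  moreover have "(1 - \<delta>) * real k * real s * (real k * (real (n - s) / real m)) =
      (1 - \<delta>) * (1 - t) * real s * (real k ^ 2 * real n / real m)"
    unfolding nt by (simp add: power2_eq_square mult_ac)
  moreover have "(1 - \<delta>) * (1 - t) * real s * ((1 + \<epsilon>) * L)
      \<le> (1 - \<delta>) * (1 - t) * real s * (real k ^ 2 * real n / real m)"
    using k \<delta>0 t by (intro mult_left_mono) auto
  ultimately have "(1 - \<delta>) * (1 - t) * real s * ((1 + \<epsilon>) * L) \<le> y * (real k * (real (n - s) / real m))"
    by linarith
  then have e: "real s * ((1 - \<delta>) * (1 - t) * (1 + \<epsilon>) * L) \<le> real k * y * real (n - s) / real m"
    by (simp add: mult_ac)
  have "real (n choose s) * t ^ s \<le> exp (real s)"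
    unfolding t_def using s by (intro binomial_times_ratio_power_le_exp) auto
  then have "real (n choose s) \<le> exp (real s) / t ^ s" using t by (simp add: field_simps)
  also have "\<dots> = exp (real s * (1 - ln t))"
    using t by (simp add: exp_diff right_diff_distrib exp_of_nat_mult)
  finally have b: "real (n choose s) \<le> exp (real s * (1 - ln t))" .
  \<comment> \<open>For \<open>t \<le> \<delta>\<close> the cost \<open>- ln t\<close> can reach
    \<open>ln n\<close>, but \<open>\<delta> = \<epsilon> / 8\<close> keeps the gain at
    \<open>(1 + \<epsilon> / 2) * ln n\<close> or more. For larger \<open>t\<close> the cost is at
    most the constant \<open>- ln \<delta>\<close>, and a quarter of \<open>ln n\<close>
    suffices.\<close>
  have main: "1 - ln t - (1 - \<delta>) * (1 - t) * (1 + \<epsilon>) * L \<le> 1 - ln \<delta> - \<epsilon> / 4 * L"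
  proof (cases "t \<le> \<delta>")
    case True
    have "\<epsilon> * \<epsilon> \<le> \<epsilon>" using \<epsilon> by (simp add: mult_left_le)
    then have "1 + \<epsilon> / 2 \<le> (1 - \<epsilon> / 4) * (1 + \<epsilon>)" by (simp add: field_simps)
    also have "1 - \<epsilon> / 4 \<le> (1 - \<delta>) * (1 - \<delta>)" by (simp add: \<delta> algebra_simps)
    also have "(1 - \<delta>) * (1 - \<delta>) \<le> (1 - \<delta>) * (1 - t)" using True \<delta>0 by (intro mult_left_mono) auto
    finally have "(1 + \<epsilon> / 2) * L \<le> (1 - \<delta>) * (1 - t) * (1 + \<epsilon>) * L"
      using \<epsilon> L by (intro mult_right_mono) auto
    moreover have "- ln t \<le> L"
    proof -
      have "1 / real n \<le> t" using s n by (simp add: t_def field_simps)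
      then have "ln (1 / real n) \<le> ln t" using n t by (subst ln_le_cancel_iff) auto
      then show ?thesis using n by (simp add: L_def ln_div)
    qed
    moreover have "ln \<delta> \<le> 0" using \<delta>0 by simp
    moreover have "\<epsilon> / 4 * L \<le> \<epsilon> / 2 * L" using \<epsilon> L by (intro mult_right_mono) auto
    ultimately show ?thesis by (simp add: algebra_simps)
  next
    case False
    have "(1 / 4) * 1 \<le> ((1 - \<delta>) * (1 - t)) * (1 + \<epsilon>)"
    proof (intro mult_mono)
      have "(1 / 2) * (1 / 2) \<le> (1 - \<delta>) * (1 - t)" using \<delta>0 t by (intro mult_mono) auto
      then show "1 / 4 \<le> (1 - \<delta>) * (1 - t)" by simp
    qed (use \<epsilon> \<delta>0 t in auto)
    then have "\<epsilon> / 4 \<le> (1 - \<delta>) * (1 - t) * (1 + \<epsilon>)" using \<epsilon> by linarith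
    then have "\<epsilon> / 4 * L \<le> (1 - \<delta>) * (1 - t) * (1 + \<epsilon>) * L" using L by (rule mult_right_mono)
    moreover have "ln \<delta> \<le> ln t" using False \<delta>0 t by (subst ln_le_cancel_iff) auto
    ultimately show ?thesis by linarith
  qed
  have "real (n choose s) * exp (- real k * y * real (n - s) / real m)
      \<le> exp (real s * (1 - ln t)) * exp (- (real s * ((1 - \<delta>) * (1 - t) * (1 + \<epsilon>) * L)))"
    using b e by (intro mult_mono) auto
  also have "\<dots> = exp (real s * (1 - ln t - (1 - \<delta>) * (1 - t) * (1 + \<epsilon>) * L))"
    by (simp add: right_diff_distrib flip: exp_add)
  also have "\<dots> \<le> exp (real s * (1 - ln \<delta> - \<epsilon> / 4 * L))" using main by (simp add: mult_left_mono)
  also have "\<dots> = exp (1 - ln \<delta> - \<epsilon> / 4 * L) ^ s" by (simp flip: exp_of_nat_mult)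
  finally show ?thesis by (simp add: L_def add_increasing)
qed

text \<open>\<open>A\<close> and \<open>B\<close> are ratios of geometric series, for small unions
  and for unions capped by \<open>(1 - \<delta>) * k * s\<close>. \<open>D\<close> handles the cap
  \<open>c * m\<close>: all binomials together cost at most \<open>2 ^ n\<close>, leaving
  \<open>D ^ n \<le> D\<close>.\<close>

lemma prob_disconnected_le_dense:
  fixes \<epsilon> \<delta> c A B D :: real
  assumes \<epsilon>: "0 < \<epsilon>" "\<epsilon> \<le> 1" and \<delta>: "\<delta> = \<epsilon> / 8" and c: "c = exp (- 2 / \<delta>)"
    and nmk: "n \<le> m" "k \<le> m" "0 < m" "1 \<le> \<delta> * real k"
    and dens: "(1 + \<epsilon>) * real m * ln (real n) \<le> real k ^ 2 * real n"
    and A: "A = exp (1 + ln (real k) - real k + 2 / \<delta>)" "A \<le> 1 / 2"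
    and B: "B = exp (1 - ln \<delta> - \<epsilon> / 4 * ln (real n))" "B \<le> 1 / 2"
    and D: "D = 2 * exp (- real k * c / 2)" "D \<le> 1" and "n \<ge> 1"
  shows "1 - prob_connected n m k \<le> 2 * A + 2 * B + D"
proof -
  \<comment> \<open>Both terms of \<open>min\<close> are needed: when \<open>k s\<close> exceeds \<open>m\<close>, the union cannot have nearly
    \<open>k s\<close> colours, but \<open>c m\<close> of them already force an edge out because \<open>k \<rightarrow> \<infinity>\<close>.\<close>
  define z where "z s = min ((1 - \<delta>) * real k * real s) (c * real m)" for s
  define x where "x s = nat \<lfloor>z s\<rfloor>" for s
  have \<delta>0: "0 < \<delta>" "\<delta> < 1" using \<epsilon> \<delta> by auto
  have c0: "0 < c" "c < 1" using \<delta>0 by (auto simp: c)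
  have z0: "z s \<ge> 0" for s using \<delta>0 c0 by (simp add: z_def)
  \<comment> \<open>Small unions need \<open>x s\<close> below \<open>z s\<close>, and large ones
    need \<open>x s + 1\<close> above it, so rounding down suits both.\<close>
  have xz: "real (x s) \<le> z s" "z s \<le> real (x s) + 1" for s
    using z0[of s] by (simp_all add: x_def)
  have zc: "z s \<le> c * real m" "z s \<le> (1 - \<delta>) * real k * real s" for s by (simp_all add: z_def)
  have "c * real m \<le> real m" using c0 by (simp add: mult_left_le_one_le)
  then have xm: "x s \<le> m" for s using xz(1)[of s] zc(1)[of s] by linarith
  have "1 - prob_connected n m k \<le> (\<Sum>s = 1..n div 2. real (n choose s) *
    (real (m choose x s) * (real (x s) / real m) ^ (k * s)
      + exp (- real k * (real (x s) + 1) * real (n - s) / real m)))"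
    by (rule prob_disconnected_le_node_cuts) (use nmk xm in auto)
  also have "\<dots> \<le> (\<Sum>s = 1..n div 2. A ^ s + (real (n choose s) * exp (- real k * c * real n / 2) + B ^ s))"
  proof (rule sum_mono)
    fix s assume s: "s \<in> {1..n div 2}"
    have "real (n choose s) * (real (m choose x s) * (real (x s) / real m) ^ (k * s)) \<le> A ^ s"
      unfolding A using s nmk \<delta>0 xz(1)[of s] zc[of s]
      by (intro small_union_term_le) (auto simp: c)
    moreover have "real (n choose s) * exp (- real k * (real (x s) + 1) * real (n - s) / real m)
        \<le> real (n choose s) * exp (- real k * c * real n / 2) + B ^ s"
      unfolding B using s nmk dens xz(2)[of s] c0
      by (intro large_union_term_le[OF \<epsilon> \<delta>]) (auto simp: z_def)
    ultimately show "real (n choose s) * (real (m choose x s) * (real (x s) / real m) ^ (k * s)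
        + exp (- real k * (real (x s) + 1) * real (n - s) / real m))
        \<le> A ^ s + (real (n choose s) * exp (- real k * c * real n / 2) + B ^ s)"
      by (simp add: distrib_left)
  qed
  also have "\<dots> = (\<Sum>s = 1..n div 2. A ^ s) + (\<Sum>s = 1..n div 2. B ^ s)
      + (\<Sum>s = 1..n div 2. real (n choose s)) * exp (- real k * c * real n / 2)"
    by (simp add: sum.distrib sum_distrib_right)
  also have "\<dots> \<le> 2 * A + 2 * B + D"
  proof (intro add_mono sum_powers_le)
    have "(\<Sum>s = 1..n div 2. n choose s) \<le> (\<Sum>s\<le>n. n choose s)" by (rule sum_mono2) auto
    also have "\<dots> = 2 ^ n" by (rule choose_row_sum)
    finally have "(\<Sum>s = 1..n div 2. real (n choose s)) \<le> 2 ^ n"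
      by (metis of_nat_le_iff of_nat_numeral of_nat_power of_nat_sum)
    then have "(\<Sum>s = 1..n div 2. real (n choose s)) * exp (- real k * c * real n / 2)
        \<le> 2 ^ n * exp (- real k * c * real n / 2)" by (rule mult_right_mono) simp
    also have "\<dots> = D ^ n"
      by (simp add: D power_mult_distrib algebra_simps flip: exp_of_nat_mult)
    also have "\<dots> \<le> D ^ 1" using D \<open>n \<ge> 1\<close> by (intro power_decreasing) auto
    finally show "(\<Sum>s = 1..n div 2. real (n choose s)) * exp (- real k * c * real n / 2) \<le> D" by simp
  qed (use A B in auto)
  finally show ?thesis .
qed

subsection \<open>The threshold\<close>

lemma prob_connected_nonneg: "0 \<le> prob_connected n m k"
  by (simp add: prob_connected_def)

lemma prob_connected_le_1: "prob_connected n m k \<le> 1"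
proof -
  have "card {F \<in> assignments n m k. ig_connected n F} \<le> card (assignments n m k)"
    by (rule card_mono) auto
  then show ?thesis by (cases "card (assignments n m k) = 0") (auto simp: prob_connected_def divide_le_eq_1)
qed

lemma prob_connected_tendsto_1I:
  assumes "\<forall>\<^sub>F n in sequentially. 1 - prob_connected n (m n) (k n) \<le> g n" "g \<longlonglongrightarrow> 0"
  shows "(\<lambda>n. prob_connected n (m n) (k n)) \<longlonglongrightarrow> 1"
proof -
  have "(\<lambda>n. 1 - prob_connected n (m n) (k n)) \<longlonglongrightarrow> 0"
    by (rule tendsto_sandwich[OF _ assms(1) tendsto_const assms(2)])
      (simp add: prob_connected_le_1)
  then have "(\<lambda>n. 1 - (1 - prob_connected n (m n) (k n))) \<longlonglongrightarrow> 1 - 0"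
    by (intro tendsto_intros)
  then show ?thesis by simp
qed

text \<open>Here \<open>n / m\<close> is at least \<open>n powr (1 - \<alpha>)\<close>, a positive
  power of \<open>n\<close>. So \<open>m * exp (- n / m)\<close> tends to 0, and the sum over colour
  cuts is dominated by a geometric series in it.\<close>

lemma connected_sparse_colours:
  fixes \<alpha> :: real
  assumes \<alpha>: "0 < \<alpha>" "\<alpha> < 1" and k: "\<And>n. k n \<ge> 2"
    and m: "\<And>n. m n = nat \<lfloor>real n powr \<alpha>\<rfloor>"
    and km: "\<forall>\<^sub>F n in sequentially. k n \<le> m n"
  shows "(\<lambda>n. prob_connected n (m n) (k n)) \<longlonglongrightarrow> 1"
proof (rule prob_connected_tendsto_1I)
  define h where "h n = real n powr \<alpha> * exp (- (real n powr (1 - \<alpha>)))" for n :: nat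
  have h0: "h \<longlonglongrightarrow> 0" unfolding h_def using \<alpha> by real_asymp
  then have ev: "\<forall>\<^sub>F n in sequentially. h n < 1 / 2" by (rule order_tendstoD) simp
  show "\<forall>\<^sub>F n in sequentially. 1 - prob_connected n (m n) (k n) \<le> 2 * h n"
    using ev km eventually_ge_at_top[of 1]
  proof eventually_elim
    case (elim n)
    define M where "M = m n"
    have M: "M > 0" using k[of n] elim by (simp add: M_def)
    have Mle: "real M \<le> real n powr \<alpha>" unfolding M_def m by simp
    have "real n powr (1 - \<alpha>) * real M \<le> real n powr (1 - \<alpha>) * real n powr \<alpha>"
      using Mle by (rule mult_left_mono) simp
    also have "\<dots> = real n" using elim by (simp flip: powr_add)
    finally have nM: "real n powr (1 - \<alpha>) \<le> real n / real M" using M by (simp add: field_simps)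
    define E where "E = real M * exp (- real n / real M)"
    have E: "0 \<le> E" "E \<le> h n" unfolding E_def h_def
      using Mle nM by (auto intro!: mult_mono)
    have "1 - prob_connected n M (k n) \<le> (\<Sum>a = 1..M div 2. real (M choose a) * exp (- real n * real a / real M))"
      using k elim by (intro prob_disconnected_le_colour_cuts) (auto simp: M_def)
    also have "\<dots> \<le> (\<Sum>a = 1..M div 2. E ^ a)"
    proof (rule sum_mono)
      fix a assume a: "a \<in> {1..M div 2}"
      have "M choose a \<le> M ^ a" using a by (intro binomial_le_pow) auto
      then have "real (M choose a) \<le> real M ^ a" by (metis of_nat_le_iff of_nat_power)
      moreover have "exp (- real n * real a / real M) = exp (- real n / real M) ^ a"
        by (simp add: mult_ac flip: exp_of_nat_mult)
      ultimately show "real (M choose a) * exp (- real n * real a / real M) \<le> E ^ a"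
        by (simp add: E_def power_mult_distrib mult_right_mono)
    qed
    also have "\<dots> \<le> 2 * E" using E elim by (intro sum_powers_le) auto
    finally show ?case using E by (simp add: M_def)
  qed
  show "(\<lambda>n. 2 * h n) \<longlonglongrightarrow> 0" using tendsto_mult[OF tendsto_const h0, of 2] by simp
qed

text \<open>With \<open>n \<le> m\<close> the density condition gives
  \<open>k\<^sup>2 \<ge> ln n\<close>, so \<open>k\<close> tends to infinity and \<open>A\<close>
  and \<open>D\<close> vanish; \<open>B\<close> vanishes with growing \<open>n\<close>.\<close>

lemma connected_many_colours:
  assumes mn: "\<forall>\<^sub>F n in sequentially. n \<le> m n"
    and km: "\<forall>\<^sub>F n in sequentially. k n \<le> m n" and \<epsilon>: "0 < \<epsilon>" "\<epsilon> \<le> 1"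
    and dens: "\<forall>\<^sub>F n in sequentially. (1 + \<epsilon>) * real (m n) * ln (real n) \<le> real (k n) ^ 2 * real n"
  shows "(\<lambda>n. prob_connected n (m n) (k n)) \<longlonglongrightarrow> 1"
proof (rule prob_connected_tendsto_1I)
  define \<delta> c where "\<delta> = \<epsilon> / 8" and "c = exp (- 2 / \<delta>)"
  have \<delta>: "\<delta> > 0" and c: "c > 0" using \<epsilon> by (auto simp: \<delta>_def c_def)
  define A B D where "A n = exp (1 + ln (real (k n)) - real (k n) + 2 / \<delta>)"
    and "B n = exp (1 - ln \<delta> - \<epsilon> / 4 * ln (real n))"
    and "D n = 2 * exp (- real (k n) * c / 2)" for n :: nat
  have "\<forall>\<^sub>F n in sequentially. sqrt (ln (real n)) \<le> real (k n)"
    using mn dens eventually_ge_at_top[of 1]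
  proof eventually_elim
    case (elim n)
    have "real n * ln (real n) \<le> (1 + \<epsilon>) * real (m n) * ln (real n)"
      using elim \<epsilon> mult_mono[of 1 "1 + \<epsilon>" "real n" "real (m n)"]
      by (intro mult_right_mono) auto
    also have "\<dots> \<le> real (k n) ^ 2 * real n" by fact
    finally have "ln (real n) \<le> real (k n) ^ 2" using elim by (simp add: mult.commute)
    then show ?case by (intro real_le_lsqrt) auto
  qed
  moreover have "filterlim (\<lambda>n. sqrt (ln (real n))) at_top sequentially" by real_asymp
  ultimately have klim: "filterlim (\<lambda>n. real (k n)) at_top sequentially"
    by (rule filterlim_at_top_mono[rotated])
  have "((\<lambda>x. exp (1 + ln x - x + 2 / \<delta>)) \<longlongrightarrow> 0) at_top" by real_asymp
  then have A0: "A \<longlonglongrightarrow> 0" unfolding A_def using klim by (rule filterlim_compose)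
  have "((\<lambda>x. 2 * exp (- x * c / 2)) \<longlongrightarrow> 0) at_top" using c by real_asymp
  then have D0: "D \<longlonglongrightarrow> 0" unfolding D_def using klim by (rule filterlim_compose)
  have B0: "B \<longlonglongrightarrow> 0" unfolding B_def using \<epsilon> by real_asymp
  have ev: "\<forall>\<^sub>F n in sequentially. A n < 1 / 2" "\<forall>\<^sub>F n in sequentially. B n < 1 / 2"
    "\<forall>\<^sub>F n in sequentially. D n < 1"
    by (rule order_tendstoD(2)[OF A0] order_tendstoD(2)[OF B0] order_tendstoD(2)[OF D0], simp)+
  have "\<forall>\<^sub>F n in sequentially. 1 / \<delta> \<le> real (k n)"
    using klim by (simp add: filterlim_at_top)
  then show "\<forall>\<^sub>F n in sequentially. 1 - prob_connected n (m n) (k n) \<le> 2 * A n + 2 * B n + D n"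
    using ev mn km dens eventually_ge_at_top[of 1]
  proof eventually_elim
    case (elim n)
    show ?case
      by (rule prob_disconnected_le_dense[OF \<epsilon> \<delta>_def c_def, of n "m n" "k n"])
        (use elim \<delta> in \<open>auto simp: A_def B_def D_def field_simps\<close>)
  qed
  have "(\<lambda>n. 2 * A n + 2 * B n + D n) \<longlonglongrightarrow> 2 * 0 + 2 * 0 + 0"
    by (intro tendsto_intros A0 B0 D0)
  then show "(\<lambda>n. 2 * A n + 2 * B n + D n) \<longlonglongrightarrow> 0" by simp
qed

text \<open>The disjointness probability \<open>q\<close> is at least
  \<open>p = 1 - z * ln n / n\<close>. The mean number of isolated nodes is thus at least of order
  \<open>n powr (1 - z)\<close>, which is unbounded as \<open>z < 1\<close>, while \<open>q\<close>
  tends to 1.\<close>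

lemma disconnected_below_threshold:
  assumes k: "\<And>n. k n \<ge> 2" and km: "\<forall>\<^sub>F n in sequentially. k n \<le> m n" and z: "0 < z" "z < 1"
    and dens: "\<forall>\<^sub>F n in sequentially. real (k n) ^ 2 * real n / (real (m n) * ln (real n)) < z"
  shows "(\<lambda>n. prob_connected n (m n) (k n)) \<longlonglongrightarrow> 0"
proof -
  define p where "p n = 1 - z * ln (real n) / real n" for n :: nat
  \<comment> \<open>The exponent \<open>n\<close> in place of \<open>n - 1\<close> is safe because
    \<open>p n \<le> q \<le> 1\<close>.\<close>
  define g where "g n = 1 / (real n * p n powr real n) + 1 / (p n)\<^sup>2 - 1" for n
  have "p \<longlonglongrightarrow> 1" unfolding p_def by real_asymp
  then have p0: "\<forall>\<^sub>F n in sequentially. p n > 0" by (rule order_tendstoD) simp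
  have g0: "g \<longlonglongrightarrow> 0" unfolding g_def p_def using z by real_asymp
  have le: "\<forall>\<^sub>F n in sequentially. prob_connected n (m n) (k n) \<le> g n"
    using km dens p0 eventually_ge_at_top[of 3]
  proof eventually_elim
    case (elim n)
    define q where "q = real ((m n - k n) choose k n) / real (m n choose k n)"
    have m: "m n > 0" using k[of n] elim by simp
    have L: "ln (real n) > 0" using elim by simp
    have "real (k n) ^ 2 / real (m n) \<le> z * ln (real n) / real n"
      using elim(2,4) L m by (simp add: field_simps)
    then have pq: "p n \<le> q"
      using disjoint_ratio_ge[of "k n" "m n"] k[of n] elim(1) by (simp add: p_def q_def)
    have q0: "q > 0" using pq elim by linarith
    have q1: "q \<le> 1"
      using binomial_right_mono[of "m n - k n" "m n" "k n"] elim(1)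
      by (simp add: q_def divide_le_eq_1)
    have "prob_connected n (m n) (k n) \<le> 1 / (real n * q ^ (n - 1)) + 1 / q\<^sup>2 - 1"
      using elim q0 by (intro prob_connected_le_second_moment q_def) auto
    also have "\<dots> \<le> g n"
    proof -
      have "p n powr real n = p n ^ n" using elim by (simp add: powr_realpow)
      also have "\<dots> \<le> q ^ n" using pq elim by (intro power_mono) auto
      also have "\<dots> \<le> q ^ (n - 1)" using q0 q1 by (intro power_decreasing) auto
      finally have "1 / (real n * q ^ (n - 1)) \<le> 1 / (real n * p n powr real n)"
        using elim q0 by (intro divide_left_mono mult_left_mono mult_pos_pos) auto
      moreover have "1 / q\<^sup>2 \<le> 1 / (p n)\<^sup>2"
        using pq elim q0 by (intro divide_left_mono power_mono) auto
      ultimately show ?thesis by (simp add: g_def)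
    qed
    finally show ?case .
  qed
  show ?thesis
    by (rule tendsto_sandwich[OF _ le tendsto_const g0]) (simp add: prob_connected_nonneg)
qed

text \<open>For \<open>k > m\<close> there is no colour set to assign, so
  \<open>k n \<le> m n\<close> for large \<open>n\<close> expresses that the random graph
  exists.\<close>

theorem theorem1:
  fixes \<alpha> :: real and k m :: "nat \<Rightarrow> nat"
  assumes "\<alpha> > 0"
    and "\<And>n. k n \<ge> 2"
    and "\<And>n. m n = nat \<lfloor>real n powr \<alpha>\<rfloor>"
    and "eventually (\<lambda>n. k n \<le> m n) sequentially"
  shows "(liminf (\<lambda>n. ereal (real (k n)^2 * real n / (real (m n) * ln (real n)))) > 1
            \<longrightarrow> (\<lambda>n. prob_connected n (m n) (k n)) \<longlonglongrightarrow> 1)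
       \<and> (limsup (\<lambda>n. ereal (real (k n)^2 * real n / (real (m n) * ln (real n)))) < 1
            \<longrightarrow> (\<lambda>n. 1 - prob_connected n (m n) (k n)) \<longlonglongrightarrow> 1)"
proof (intro conjI impI)
  let ?r = "\<lambda>n. real (k n)^2 * real n / (real (m n) * ln (real n))"
  assume "liminf (\<lambda>n. ereal (?r n)) > 1"
  \<comment> \<open>A real \<open>w\<close> strictly in between gives a fixed margin, also when the
    lower limit is infinite.\<close>
  then obtain w where w: "1 < ereal w" "ereal w < liminf (\<lambda>n. ereal (?r n))"
    using ereal_dense2 by blast
  show "(\<lambda>n. prob_connected n (m n) (k n)) \<longlonglongrightarrow> 1"
  proof (cases "\<alpha> < 1")
    case True
    then show ?thesis using assms by (intro connected_sparse_colours) auto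
  next
    case False
    \<comment> \<open>The cap at 1 meets the requirement \<open>\<epsilon> \<le> 1\<close> of the
      cut estimates.\<close>
    define \<epsilon> where "\<epsilon> = min (w - 1) 1"
    have \<epsilon>: "0 < \<epsilon>" "\<epsilon> \<le> 1" "1 + \<epsilon> \<le> w" using w by (auto simp: \<epsilon>_def)
    have mn: "\<forall>\<^sub>F n in sequentially. n \<le> m n"
      using eventually_ge_at_top[of 1]
    proof eventually_elim
      case (elim n)
      have "real n powr 1 \<le> real n powr \<alpha>" using False elim by (intro powr_mono) auto
      then show ?case using elim unfolding assms(3) by (simp add: le_nat_floor)
    qed
    have "\<forall>\<^sub>F n in sequentially. ereal w < ereal (?r n)" by (rule less_LiminfD[OF w(2)])
    then have "\<forall>\<^sub>F n in sequentially. (1 + \<epsilon>) * real (m n) * ln (real n) \<le> real (k n) ^ 2 * real n"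
      using assms(4) eventually_ge_at_top[of 2]
    proof eventually_elim
      case (elim n)
      have pos: "real (m n) * ln (real n) > 0" using elim assms(2)[of n] by simp
      have "(1 + \<epsilon>) * (real (m n) * ln (real n)) \<le> w * (real (m n) * ln (real n))"
        using \<epsilon> pos by (intro mult_right_mono) auto
      also have "\<dots> \<le> real (k n) ^ 2 * real n" using elim(1) pos by (simp add: pos_less_divide_eq)
      finally show ?case by (simp add: mult.assoc)
    qed
    then show ?thesis using assms(4) mn \<epsilon>(1,2) by (intro connected_many_colours)
  qed
next
  let ?r = "\<lambda>n. real (k n)^2 * real n / (real (m n) * ln (real n))"
  assume "limsup (\<lambda>n. ereal (?r n)) < 1"
  then obtain w where w: "limsup (\<lambda>n. ereal (?r n)) < ereal w" "ereal w < 1"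
    using ereal_dense2 by blast
  have "\<forall>\<^sub>F n in sequentially. ereal (?r n) < ereal w" by (rule Limsup_lessD[OF w(1)])
  \<comment> \<open>The maximum with \<open>1 / 2\<close> makes the bound visibly positive and keeps
    it below 1.\<close>
  then have "\<forall>\<^sub>F n in sequentially. ?r n < max w (1 / 2)" by (rule eventually_mono) auto
  then have "(\<lambda>n. prob_connected n (m n) (k n)) \<longlonglongrightarrow> 0"
    using assms(2,4) w(2) by (intro disconnected_below_threshold[where z = "max w (1 / 2)"]) auto
  then have "(\<lambda>n. 1 - prob_connected n (m n) (k n)) \<longlonglongrightarrow> 1 - 0" by (intro tendsto_intros)
  then show "(\<lambda>n. 1 - prob_connected n (m n) (k n)) \<longlonglongrightarrow> 1" by simp
qed

end
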